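(* Let $r \ge 1$ and $\ell \ge 2$ be integers, and let $m$ be a positive integer with $m \equiv -r \pmod{\ell}$ and $\gcd(m,\ell)=1$. Let $s$ be a non-negative integer such that $m > \frac{2\ell s + r}{\ell - 1}$. Then $$\sum_{n=s}^{\frac{m+r}{\ell}+s} (-1)^n \frac{(q^{-r};q^{\ell})_{n+s}\,(q^{-r};q^{\ell})_{n-s}\,(q^{-r};q^{\ell})_n}{(q^{\ell};q^{\ell})_{n+s}\,(q^{\ell};q^{\ell})_{n-s}\,(q^{\ell};q^{\ell})_n}\Big\{[\ell(n+s)-r]\,[\ell(n-s)-r]\,[\ell n-r] + [\ell(n+s)]\,[\ell(n-s)]\,[\ell n]\Big\} \equiv 0 \pmod{[m]\,\Phi_m(q)^2}.$$
   Context: For the purposes of the congruence, $q$ is treated as an indeterminate and all expressions are rational functions of $q$ (elements of $\mathbb{Q}(q)$). The $q$-shifted factorial is $(a;q)_0 = 1$ and $(a;q)_n = \prod_{k=0}^{n-1}(1-aq^k)$ for $n\ge 1$; thus $(q^{-r};q^{\ell})_n = \prod_{k=0}^{n-1}(1-q^{\ell k - r})$ and $(q^{\ell};q^{\ell})_n = \prod_{k=1}^{n}(1-q^{\ell k})$. For any integer $k$ (possibly negative or zero), $[k] = \frac{1-q^k}{1-q}$ is the $q$-integer; for positive $m$, $[m] = 1+q+\cdots+q^{m-1}$. $\Phi_m(q)$ is the $m$-th cyclotomic polynomial. Congruence convention: for a rational function $A(q)$ and a polynomial $P(q)\in\mathbb{Z}[q]$, $A(q)\equiv 0 \pmod{P(q)}$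 means that, when $A(q)$ is written in lowest terms as a quotient of two polynomials, $P(q)$ divides the numerator (equivalently, $A(q) = P(q)\,B(q)/C(q)$ with $B, C$ polynomials and $C$ coprime to $P$). Powers of $q$ are coprime to $P$ here, so negative powers of $q$ cause no difficulty. *)

theory Defs
  imports
    Complex_Main
    "HOL-Computational_Algebra.Computational_Algebra"
    "HOL-Computational_Algebra.Field_as_Ring"
    "HOL-Number_Theory.Cong"
begin

section \<open>Rational functions of $q$\<close>

type_synonym ratfun = "rat poly fract"

definition qvar :: ratfun where
  "qvar = to_fract [:0, 1:]"

definition q_poch :: "'a :: comm_ring_1 \<Rightarrow> 'a \<Rightarrow> nat \<Rightarrow> 'a" where
  "q_poch a p n = (\<Prod>k<n. 1 - a * p ^ k)"

definition q_int :: "int \<Rightarrow> ratfun" where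
  "q_int k = (1 - qvar powi k) / (1 - qvar)"

text \<open>
  The $q$-integer of a natural number as an element of $Z[q]$, needed because a modulus is an
  integer polynomial; lemma \<open>q_int_of_nat\<close> below links it to \<^const>\<open>q_int\<close>.
\<close>

definition q_int_poly :: "nat \<Rightarrow> int poly" where
  "q_int_poly m = (\<Sum>i<m. monom 1 i)"


section \<open>Congruences between rational functions\<close>

text \<open>
  \<^const>\<open>quot_of_fract\<close> returns numerator and (monic) denominator in lowest terms. Divisibility is
  taken in $Q[q]$.
\<close>

definition vanishes_mod :: "ratfun \<Rightarrow> int poly \<Rightarrow> bool" where
  "vanishes_mod A P \<longleftrightarrow> map_poly of_int P dvd fst (quot_of_fract A)"

lemma vanishes_mod_iff:
  "vanishes_mod A P \<longleftrightarrow>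
     (\<exists>B C. C \<noteq> 0 \<and> coprime C (map_poly of_int P) \<and>
            A = to_fract (map_poly of_int P * B) / to_fract C)"
proof
  define P' :: "rat poly" where "P' = map_poly of_int P"
  obtain a c where ac: "quot_of_fract A = (a, c)" by (cases "quot_of_fract A")
  have nf: "(a, c) \<in> normalized_fracts"
    using quot_of_fract_in_normalized_fracts[of A] by (simp add: ac)
  hence cop: "coprime a c" and c: "c \<noteq> 0" by (auto simp: normalized_fracts_def)
  have A: "A = to_fract a / to_fract c"
    using quot_to_fract_quot_of_fract[of A] by (simp add: ac quot_to_fract_def Fract_conv_to_fract)
  {
    assume "vanishes_mod A P"
    hence "P' dvd a" by (simp add: vanishes_mod_def ac P'_def)
    then obtain B where B: "a = P' * B" by (elim dvdE)
    with cop have "coprime c P'" by (simp add: coprime_commute)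
    with A B c show "\<exists>B C. C \<noteq> 0 \<and> coprime C (map_poly of_int P) \<and>
            A = to_fract (map_poly of_int P * B) / to_fract C"
      unfolding P'_def by blast
  }
  assume "\<exists>B C. C \<noteq> 0 \<and> coprime C (map_poly of_int P) \<and>
            A = to_fract (map_poly of_int P * B) / to_fract C"
  then obtain B C where BC: "C \<noteq> 0" "coprime C P'" "A = to_fract (P' * B) / to_fract C"
    unfolding P'_def by blast
  have "to_fract a * to_fract C = to_fract (P' * B) * to_fract c"
    using A BC c by (simp add: field_simps del: to_fract_mult)
  hence "a * C = P' * B * c"
    by (metis to_fract_mult to_fract_eq_iff)
  hence "P' dvd a * C" by (simp add: mult.assoc)
  with BC(2) have "P' dvd a"
    by (simp add: coprime_dvd_mult_left_iff coprime_commute)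
  thus "vanishes_mod A P" by (simp add: vanishes_mod_def ac P'_def)
qed


section \<open>Cyclotomic polynomials\<close>

definition primitive_roots :: "nat \<Rightarrow> complex set" where
  "primitive_roots n = {z. z ^ n = 1 \<and> (\<forall>k. 0 < k \<and> k < n \<longrightarrow> z ^ k \<noteq> 1)}"

text \<open>
  The description is well-defined for positive \<open>n\<close> by lemma \<open>cyclotomic_eq\<close> below.
\<close>

definition cyclotomic :: "nat \<Rightarrow> int poly" where
  "cyclotomic n = (THE p. map_poly of_int p = (\<Prod>z\<in>primitive_roots n. [:-z, 1:]))"

lemma coeff_map_poly_of_int [simp]:
  "coeff (map_poly of_int p) i = of_int (coeff p i)"
  by (simp add: coeff_map_poly)

lemma map_poly_of_int_add: "map_poly of_int (p + q) = map_poly of_int p + map_poly of_int q"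
  by (intro poly_eqI) simp

lemma map_poly_of_int_diff:
  "(map_poly of_int (p - q) :: 'a :: ring_1 poly) = map_poly of_int p - map_poly of_int q"
  by (intro poly_eqI) simp

lemma map_poly_of_int_mult:
  "(map_poly of_int (p * q) :: 'a :: comm_ring_1 poly) = map_poly of_int p * map_poly of_int q"
  by (intro poly_eqI) (simp add: coeff_mult)

lemma map_poly_of_int_prod:
  "(map_poly of_int (prod f A) :: 'a :: comm_ring_1 poly) = (\<Prod>x\<in>A. map_poly of_int (f x))"
  by (induction A rule: infinite_finite_induct) (simp_all add: map_poly_of_int_mult)

lemma map_poly_of_int_sum:
  "map_poly of_int (sum f A) = (\<Sum>x\<in>A. map_poly of_int (f x))"
  by (induction A rule: infinite_finite_induct) (simp_all add: map_poly_of_int_add)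

lemma map_poly_of_int_eq_iff:
  "(map_poly of_int p :: 'a :: ring_char_0 poly) = map_poly of_int q \<longleftrightarrow> p = q"
  by (simp add: poly_eq_iff)

lemma degree_map_poly_of_int:
  "degree (map_poly of_int p :: 'a :: ring_char_0 poly) = degree p"
  by (rule degree_map_poly) simp

lemma q_int_of_nat: "q_int (int m) = to_fract (map_poly of_int (q_int_poly m))"
proof -
  have "qvar \<noteq> 1"
    by (metis qvar_def to_fract_1 to_fract_eq_iff one_pCons pCons_eq_iff zero_neq_one)
  moreover have "to_fract (map_poly of_int (q_int_poly m)) = (\<Sum>i<m. qvar ^ i)"
  proof -
    have "to_fract ([:0, 1:] ^ i) = qvar ^ i" for i
      unfolding qvar_def by (induction i) (simp_all del: mult_pCons_left)
    moreover have "(monom 1 i :: rat poly) = [:0, 1:] ^ i" for i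
      by (simp add: monom_altdef)
    ultimately show ?thesis
      by (simp add: q_int_poly_def map_poly_of_int_sum map_poly_monom)
  qed
  ultimately show ?thesis
    by (simp add: q_int_def sum_gp_strict)
qed

lemma finite_primitive_roots: "n > 0 \<Longrightarrow> finite (primitive_roots n)"
  by (rule finite_subset[OF _ finite_roots_unity[of n]]) (auto simp: primitive_roots_def)

lemma roots_unity_eq_Union:
  assumes "n > 0"
  shows   "{z :: complex. z ^ n = 1} = (\<Union>d\<in>{d. d dvd n}. primitive_roots d)"
proof (intro equalityI subsetI)
  fix z :: complex assume "z \<in> {z. z ^ n = 1}"
  hence z: "z ^ n = 1" by simp
  define d where "d = (LEAST k. k > 0 \<and> z ^ k = 1)"
  have d: "d > 0 \<and> z ^ d = 1"
    unfolding d_def by (rule LeastI[of _ n]) (use z assms in auto)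
  have min: "z ^ k \<noteq> 1" if "0 < k" "k < d" for k
    using not_less_Least[of k "\<lambda>k. k > 0 \<and> z ^ k = 1"] that unfolding d_def by auto
  have "z ^ n = z ^ (d * (n div d) + n mod d)" by simp
  also have "\<dots> = z ^ (n mod d)"
    unfolding power_add power_mult using d by simp
  finally have "z ^ (n mod d) = 1" using z by simp
  with min[of "n mod d"] d have "n mod d = 0" by force
  hence "d dvd n" by auto
  moreover have "z \<in> primitive_roots d"
    using d min by (auto simp: primitive_roots_def)
  ultimately show "z \<in> (\<Union>d\<in>{d. d dvd n}. primitive_roots d)" by blast
next
  fix z assume "z \<in> (\<Union>d\<in>{d. d dvd n}. primitive_roots d)"
  then obtain d where d: "d dvd n" "z ^ d = 1" by (auto simp: primitive_roots_def)
  thus "z \<in> {z. z ^ n = 1}" by (auto elim!: dvdE simp: power_mult)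
qed

lemma primitive_roots_disjoint:
  assumes "d > 0" "e > 0" "d \<noteq> e"
  shows   "primitive_roots d \<inter> primitive_roots e = {}"
  using assms unfolding primitive_roots_def by (cases d e rule: linorder_cases) auto

lemma monom_minus_1_eq_prod:
  assumes "n > 0"
  shows   "monom 1 n - 1 = (\<Prod>z | z ^ n = 1. [:- z, 1 :: complex:])"
proof (rule poly_eqI_degree_lead_coeff[where n = n])
  let ?A = "{z :: complex. z ^ n = 1}"
  let ?P = "\<Prod>z\<in>?A. [:- z, 1:]"
  have card: "card ?A = n" using assms by (rule card_roots_unity_eq)
  have fin: "finite ?A" using assms by (intro finite_roots_unity) auto
  have deg: "degree ?P = n"
    using degree_prod_sum_eq[of ?A "\<lambda>z. [:- z, 1:]"] card by simp
  have "lead_coeff ?P = 1" by (simp add: lead_coeff_prod)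
  with deg have "coeff ?P n = 1" by simp
  thus "coeff (monom 1 n - 1) n = coeff ?P n" using assms by simp
  show "card ?A \<ge> n" using card by simp
  show "degree (monom 1 n - 1 :: complex poly) \<le> n"
    by (rule degree_diff_le) (auto simp: degree_monom_le)
  show "degree ?P \<le> n" using deg by simp
  fix z assume "z \<in> ?A"
  moreover from this fin have "poly ?P z = 0" by (auto simp: poly_prod prod_zero_iff)
  ultimately show "poly (monom 1 n - 1) z = poly ?P z" by (simp add: poly_monom)
qed

lemma ex_int_poly_primitive_roots:
  assumes "n > 0"
  shows   "\<exists>p. map_poly of_int p = (\<Prod>z\<in>primitive_roots n. [:- z, 1:])"
  using assms
proof (induction n rule: less_induct)
  case (less n)
  define C where "C = (\<lambda>n. \<Prod>z\<in>primitive_roots n. [:- z, 1 :: complex:])"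
  define S where "S = {d. d dvd n} - {n}"
  have S: "d > 0 \<and> d < n" if "d \<in> S" for d
    using that less.prems dvd_imp_le[of d n] by (cases "d = 0") (auto simp: S_def)
  have "\<forall>d\<in>S. \<exists>p. map_poly of_int p = C d"
    using less.IH S unfolding C_def by blast
  then obtain f where f: "\<And>d. d \<in> S \<Longrightarrow> map_poly of_int (f d) = C d" by metis
  define D where "D = prod f S"
  have D: "map_poly of_int D = prod C S"
    by (simp add: D_def map_poly_of_int_prod f)
  have "lead_coeff (map_poly of_int D :: complex poly) = 1"
    by (simp add: D C_def lead_coeff_prod)
  hence lcD: "lead_coeff D = 1" by (simp add: degree_map_poly_of_int)
  hence D0: "D \<noteq> 0" by auto
  have fin: "finite {d. d dvd n}" using less.prems by simp
  have "monom 1 n - 1 = (\<Prod>z | z ^ n = 1. [:- z, 1 :: complex:])"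
    using less.prems by (rule monom_minus_1_eq_prod)
  also have "\<dots> = (\<Prod>d | d dvd n. C d)"
    unfolding roots_unity_eq_Union[OF less.prems] C_def
  proof (rule prod.UNION_disjoint)
    have pos: "d > 0" if "d dvd n" for d using that less.prems by (cases "d = 0") auto
    show "\<forall>i\<in>{d. d dvd n}. finite (primitive_roots i)"
      using pos finite_primitive_roots by blast
    show "\<forall>i\<in>{d. d dvd n}. \<forall>j\<in>{d. d dvd n}. i \<noteq> j \<longrightarrow> primitive_roots i \<inter> primitive_roots j = {}"
      using pos primitive_roots_disjoint by blast
  qed (rule fin)
  also have "\<dots> = C n * prod C S"
    unfolding S_def using fin by (subst prod.remove[of _ n]) auto
  finally have fact: "monom 1 n - 1 = C n * map_poly of_int D" by (simp add: D)

  obtain q r where qr: "pseudo_divmod (monom 1 n - 1) D = (q, r)" by fastforce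
  from pseudo_divmod[OF D0 qr] lcD
  have "monom 1 n - 1 = D * q + r" and r: "r = 0 \<or> degree r < degree D" by auto
  from arg_cong[OF this(1), of "map_poly of_int :: int poly \<Rightarrow> complex poly"]
  have "(monom 1 n - 1 :: complex poly) = map_poly of_int D * map_poly of_int q + map_poly of_int r"
    by (simp add: map_poly_of_int_add map_poly_of_int_diff map_poly_of_int_mult map_poly_monom)
  hence eq: "map_poly of_int D * (C n - map_poly of_int q) = map_poly of_int r"
    using fact by (simp add: algebra_simps)
  have "C n - map_poly of_int q = 0"
  proof (rule ccontr)
    assume *: "C n - map_poly of_int q \<noteq> 0"
    have D0': "(map_poly of_int D :: complex poly) \<noteq> 0"
      using D0 map_poly_of_int_eq_iff[of D 0, where ?'a = complex] by simp
    from * D0' eq have "r \<noteq> 0" by auto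
    moreover have "degree (map_poly of_int r :: complex poly) \<ge> degree (map_poly of_int D :: complex poly)"
      unfolding eq[symmetric] using * D0' by (subst degree_mult_eq) auto
    ultimately show False using r by (simp add: degree_map_poly_of_int)
  qed
  thus ?case unfolding C_def by (intro exI[of _ q]) simp
qed

lemma cyclotomic_eq:
  assumes "n > 0"
  shows   "map_poly of_int (cyclotomic n) = (\<Prod>z\<in>primitive_roots n. [:- z, 1:])"
  unfolding cyclotomic_def
proof (rule theI')
  show "\<exists>!p. map_poly of_int p = (\<Prod>z\<in>primitive_roots n. [:- z, 1:])"
    using ex_int_poly_primitive_roots[OF assms] map_poly_of_int_eq_iff[where ?'a = complex] by metis
qed

end

theory Submission
  imports Defs
begin

text \<open>
  Write $a = q^{-r}$, $p = q^l$, $N = (m + r) / l$ and $V_n = (a;p)_{n+1} / (p;p)_n$. If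
  $u_n = (a;p)_n / (p;p)_n$, then $u_n (1 - a p^n) = V_n$ and $u_n (1 - p^n) = V_{n-1}$, so the
  sum telescopes to $\pm V_{N+2s} V_N V_{N+s} / (1-q)^3$.
  Let $z \neq 1$ be a primitive $d$-th root of unity with $d$ dividing $m$. As $l$ is invertible
  mod $d$ and $l N - r = m$, the numerator of $V_n$ vanishes at $z$ to order at least the number
  of $k \le n$ with $k \equiv N$ mod $d$, and the denominator to order exactly
  $\lfloor n/d \rfloor$. Hence no $V_n$ has a pole at $z$, and $V_N$ has a zero there. The
  hypothesis on $m$ says $N + 2s < m$, so for $d = m$ all three denominators are nonzero at $z$
  and all three numerators vanish.
\<close>

section \<open>Telescoping of the sum\<close>

lemma telescoping_sum:
  fixes a p :: "'a :: field" and V :: "nat \<Rightarrow> 'a"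
  assumes p: "\<And>k. k > 0 \<Longrightarrow> p ^ k \<noteq> 1"
  defines "V \<equiv> \<lambda>n. q_poch a p (Suc n) / q_poch p p n"
  shows "(\<Sum>n = s..M + s. (-1) ^ n *
           ((q_poch a p (n + s) * q_poch a p (n - s) * q_poch a p n) /
            (q_poch p p (n + s) * q_poch p p (n - s) * q_poch p p n)) *
           ((1 - a * p ^ (n + s)) * (1 - a * p ^ (n - s)) * (1 - a * p ^ n) +
            (1 - p ^ (n + s)) * (1 - p ^ (n - s)) * (1 - p ^ n)))
         = (-1) ^ (M + s) * (V (M + 2 * s) * V M * V (M + s))"
proof -
  define u where "u n = q_poch a p n / q_poch p p n" for n
  have u_up: "u n * (1 - a * p ^ n) = V n" for n
    by (simp add: u_def V_def q_poch_def)
  have u_down: "u (Suc n) * (1 - p ^ Suc n) = V n" for n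
    using p[of "Suc n"] by (simp add: u_def V_def q_poch_def)
  define f where "f n = (-1) ^ n * (u (n + s) * u (n - s) * u n) *
           ((1 - a * p ^ (n + s)) * (1 - a * p ^ (n - s)) * (1 - a * p ^ n) +
            (1 - p ^ (n + s)) * (1 - p ^ (n - s)) * (1 - p ^ n))" for n
  have f: "f n = (-1) ^ n * (V (n + s) * V (n - s) * V n +
      (u (n + s) * (1 - p ^ (n + s))) * (u (n - s) * (1 - p ^ (n - s))) * (u n * (1 - p ^ n)))" for n
    by (simp add: f_def flip: u_up) (simp add: algebra_simps)
  have "sum f {s..M + s} = (-1) ^ (M + s) * (V (M + 2 * s) * V M * V (M + s))"
  proof (induction M)
    case 0
    \<comment> \<open>At \<open>n = s\<close> the second product contains
      \<open>1 - p ^ 0 = 0\<close>, so the lower end of the sum leaves no boundary term.\<close>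
    show ?case by (simp add: f mult_2)
  next
    case (Suc M)
    \<comment> \<open>With \<open>W n = V (n + s) * V (n - s) * V n\<close>, the term at
      \<open>n > s\<close> is \<open>(-1) ^ n * (W n + W (n - 1))\<close>. Its second half cancels
      the closed form for \<open>M\<close>.\<close>
    have "f (Suc (M + s)) = (-1) ^ Suc (M + s) *
        (V (Suc M + 2 * s) * V (Suc M) * V (Suc M + s) + V (M + 2 * s) * V M * V (M + s))"
      using u_down[of "M + 2 * s"] u_down[of M] u_down[of "M + s"]
      by (simp add: f mult_2 add.assoc Suc_diff_le)
    thus ?case by (simp add: Suc.IH) (simp add: algebra_simps)
  qed
  moreover have "(\<Sum>n = s..M + s. (-1) ^ n *
           ((q_poch a p (n + s) * q_poch a p (n - s) * q_poch a p n) /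
            (q_poch p p (n + s) * q_poch p p (n - s) * q_poch p p n)) *
           ((1 - a * p ^ (n + s)) * (1 - a * p ^ (n - s)) * (1 - a * p ^ n) +
            (1 - p ^ (n + s)) * (1 - p ^ (n - s)) * (1 - p ^ n))) = sum f {s..M + s}"
    by (simp add: f_def u_def)
  ultimately show ?thesis by simp
qed

section \<open>Orders of numerators and denominators at roots of unity\<close>

text \<open>
  The numerator of $V_n$, multiplied by $q^{r(n+1)}$ to clear the negative powers of $q$.
\<close>

definition numer :: "nat \<Rightarrow> nat \<Rightarrow> nat \<Rightarrow> 'a :: comm_ring_1 poly" where
  "numer r l n = (\<Prod>k\<le>n. monom 1 r - monom 1 (l * k))"

definition denom :: "nat \<Rightarrow> nat \<Rightarrow> 'a :: comm_ring_1 poly" where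
  "denom l n = (\<Prod>k<n. 1 - monom 1 (l * Suc k))"

lemma numer_Suc: "numer r l (Suc n) = numer r l n * (monom 1 r - monom 1 (l * Suc n))"
  by (simp add: numer_def)

lemma denom_Suc: "denom l (Suc n) = denom l n * (1 - monom 1 (l * Suc n))"
  by (simp add: denom_def)

lemma one_minus_monom_neq_0: "j > 0 \<Longrightarrow> (1 - monom 1 j :: 'a :: comm_ring_1 poly) \<noteq> 0"
  by (auto simp: poly_eq_iff intro!: exI[of _ 0])

lemma denom_neq_0: "l > 0 \<Longrightarrow> (denom l n :: 'a :: idom poly) \<noteq> 0"
  unfolding denom_def prod_zero_iff[OF finite_lessThan]
  using one_minus_monom_neq_0[of "l * Suc _"] by (metis nat_0_less_mult_iff zero_less_Suc)

text \<open>A factor is zero only if \<open>r = l * k\<close>. Orders can be added over a product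
  only when the product is nonzero.\<close>

lemma numer_neq_0: "\<not> l dvd r \<Longrightarrow> (numer r l n :: 'a :: idom poly) \<noteq> 0"
  by (auto simp: numer_def monom_eq_iff')

text \<open>The zeros of \<open>1 - q ^ j\<close> are simple: the derivative can vanish only at 0,
  which is not a zero. Since \<open>z\<close> has exact order \<open>d\<close>, it is a zero just
  when \<open>d\<close> divides \<open>j\<close>.\<close>

lemma order_one_minus_monom:
  fixes z :: complex
  assumes z: "z \<in> primitive_roots d" and "d > 0" "j > 0"
  shows "order z (1 - monom 1 j) = (if d dvd j then 1 else 0)"
proof -
  have "rsquarefree (1 - monom 1 j :: complex poly)"
    using \<open>j > 0\<close> 
    by (auto simp: rsquarefree_roots poly_monom pderiv_diff pderiv_monom power_0_left)
  hence le: "order z (1 - monom 1 j) = 0 \<or> order z (1 - monom 1 j) = 1"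
    by (auto simp: rsquarefree_def)
  have zd: "z ^ d = 1" using z by (simp add: primitive_roots_def)
  have "z ^ j = z ^ (d * (j div d) + j mod d)" by simp
  also have "\<dots> = z ^ (j mod d)" unfolding power_add power_mult zd by simp
  finally have "z ^ j = 1 \<longleftrightarrow> d dvd j"
    using z \<open>d > 0\<close> by (cases "j mod d = 0") (auto simp: primitive_roots_def dvd_eq_mod_eq_0)
  hence "poly (1 - monom 1 j) z = 0 \<longleftrightarrow> d dvd j"
    by (auto simp: poly_monom)
  hence "order z (1 - monom 1 j) > 0 \<longleftrightarrow> d dvd j"
    by (simp only: order_gt_0_iff[OF one_minus_monom_neq_0[OF \<open>j > 0\<close>]])
  thus ?thesis using le by auto
qed

text \<open>As \<open>l\<close> is coprime to \<open>d\<close>, the factor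
  \<open>1 - q ^ (l * Suc k)\<close> vanishes at \<open>z\<close> exactly when
  \<open>d dvd Suc k\<close>. The multiples of \<open>d\<close> among 1, ..., \<open>n\<close>
  number \<open>n div d\<close>.\<close>

lemma order_denom:
  assumes "z \<in> primitive_roots d" "d > 0" "l > 0" "coprime d l"
  shows "order z (denom l n) = n div d"
proof (induction n)
  case (Suc n)
  have "d dvd l * Suc n \<longleftrightarrow> d dvd Suc n"
    using assms(4) by (simp only: coprime_dvd_mult_right_iff)
  thus ?case using Suc assms denom_neq_0[OF \<open>l > 0\<close>, of "Suc n", where ?'a = complex]
    by (simp add: denom_Suc order_mult order_one_minus_monom div_Suc dvd_eq_mod_eq_0
        del: mult_Suc_right)
qed (simp add: denom_def)

text \<open>
  The quotient on the left is the number of $k \le n$ with $k \equiv N$ mod $d$.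
\<close>

lemma order_numer_ge:
  fixes z :: complex
  assumes z: "z ^ d = 1" "z ^ (l * N) = z ^ r" and d: "d > 0" and r: "\<not> l dvd r"
  shows "(n + (d - N mod d)) div d \<le> order z (numer r l n)"
proof (induction n)
  have "z ^ (l * N) = z ^ (l * (N mod d) + d * (l * (N div d)))"
    by (metis add.commute distrib_left mod_mult_div_eq mult.left_commute)
  hence eq: "z ^ r = z ^ (l * (N mod d))"
    unfolding z(2)[symmetric] power_add power_mult z(1) by simp
  {
    \<comment> \<open>The only factor is \<open>q ^ r - 1\<close>. The count is 1 exactly when
      \<open>d dvd N\<close>, and then \<open>z ^ r = z ^ 0 = 1\<close>.\<close>
    case 0
    have "d - N mod d < d" if "N mod d \<noteq> 0" using d that by simp
    moreover have "order z (numer r l 0) > 0" if "N mod d = 0"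
      using eq that numer_neq_0[OF r, of 0, where ?'a = complex]
      by (subst order_gt_0_iff) (auto simp: numer_def poly_monom)
    ultimately show ?case using d by (cases "N mod d = 0") auto
  next
    case (Suc n)
    \<comment> \<open>The count grows exactly when \<open>Suc n\<close> is congruent to
      \<open>N\<close> mod \<open>d\<close>. Then
      \<open>z ^ (l * Suc n) = z ^ (l * N) = z ^ r\<close>, so the new factor vanishes at
      \<open>z\<close>.\<close>
    have "order z (monom 1 r - monom 1 (l * Suc n)) > 0" if "d dvd Suc (n + (d - N mod d))"
    proof -
      have "[Suc n + (d - N mod d) + N mod d = N mod d] (mod d)"
        using that by (intro cong_add_rcancel_0_nat[THEN iffD2]) (simp add: cong_0_iff)
      moreover have "Suc n + (d - N mod d) + N mod d = Suc n + d"
        using mod_less_divisor[OF d, of N] by linarith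
      ultimately have "[Suc n = N mod d] (mod d)"
        by (metis cong_def mod_add_self2)
      hence "[l * Suc n = l * (N mod d)] (mod d)" by (rule cong_scalar_left)
      hence "(l * Suc n) mod d = (l * (N mod d)) mod d" by (simp only: cong_def)
      moreover have "z ^ k = z ^ (k mod d)" for k
        by (metis mod_mult_div_eq mult.right_neutral power_add power_mult power_one z(1))
      ultimately have "z ^ (l * Suc n) = z ^ r" using eq by metis
      moreover have "(monom 1 r - monom 1 (l * Suc n) :: complex poly) \<noteq> 0"
        using numer_neq_0[OF r, of "Suc n", where ?'a = complex] by (auto simp: numer_Suc)
      ultimately show ?thesis by (subst order_gt_0_iff) (auto simp: poly_monom)
    qed
    moreover have "order z (numer r l (Suc n)) =
        order z (numer r l n) + order z (monom 1 r - monom 1 (l * Suc n))"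
      using numer_neq_0[OF r, of "Suc n"] unfolding numer_Suc by (rule order_mult)
    moreover have "(Suc n + (d - N mod d)) div d = (n + (d - N mod d)) div d +
        (if d dvd Suc (n + (d - N mod d)) then 1 else 0)"
      unfolding add_Suc div_Suc[of "n + (d - N mod d)" d] dvd_eq_mod_eq_0 by simp
    ultimately show ?case using Suc.IH by (simp split: if_splits)
  }
qed

section \<open>From orders at complex roots to divisibility over the rationals\<close>

text \<open>Powers of distinct monic linear polynomials are coprime, because a common divisor of
  \<open>[:-x, 1:]\<close> and \<open>[:-z, 1:]\<close> divides the nonzero constant
  \<open>z - x\<close>.\<close>

lemma prod_linear_powers_dvd:
  fixes a :: "complex poly"
  assumes "finite R" "\<And>z. z \<in> R \<Longrightarrow> [:-z, 1:] ^ e z dvd a"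
  shows "(\<Prod>z\<in>R. [:-z, 1:] ^ e z) dvd a"
  using assms
proof (induction R rule: finite_induct)
  case (insert x R)
  have "coprime ([:-x, 1:] ^ e x) (\<Prod>z\<in>R. [:-z, 1:] ^ e z)"
  proof (rule prod_coprime_right)
    fix z assume "z \<in> R"
    hence "x \<noteq> z" using insert by auto
    have "coprime [:-x, 1:] [:-z, 1:]"
    proof (rule coprimeI)
      fix c assume "c dvd [:-x, 1:]" "c dvd [:-z, 1:]"
      hence "c dvd [:-x, 1:] - [:-z, 1:]" by (rule dvd_diff)
      hence "c dvd [:z - x:]" by simp
      moreover have "[:z - x:] dvd 1" using \<open>x \<noteq> z\<close> by (simp add: is_unit_const_poly_iff dvd_field_iff)
      ultimately show "is_unit c" by (rule dvd_trans)
    qed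
    thus "coprime ([:-x, 1:] ^ e x) ([:-z, 1:] ^ e z)"
      by (metis coprime_power_left_iff coprime_power_right_iff)
  qed
  thus ?case using insert by (simp add: divides_mult)
qed simp

lemma map_poly_of_rat_add:
  "(map_poly of_rat (p + q) :: 'a :: field_char_0 poly) = map_poly of_rat p + map_poly of_rat q"
  by (intro poly_eqI) (simp add: coeff_map_poly of_rat_add)

lemma map_poly_of_rat_diff:
  "(map_poly of_rat (p - q) :: 'a :: field_char_0 poly) = map_poly of_rat p - map_poly of_rat q"
  by (intro poly_eqI) (simp add: coeff_map_poly of_rat_diff)

lemma map_poly_of_rat_mult:
  "(map_poly of_rat (p * q) :: 'a :: field_char_0 poly) = map_poly of_rat p * map_poly of_rat q"
  by (intro poly_eqI) (simp add: coeff_mult coeff_map_poly of_rat_sum of_rat_mult)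

lemma map_poly_of_rat_prod:
  "(map_poly of_rat (prod f A) :: 'a :: field_char_0 poly) = (\<Prod>x\<in>A. map_poly of_rat (f x))"
  by (induction A rule: infinite_finite_induct) (simp_all add: map_poly_of_rat_mult)

lemma map_poly_of_rat_power:
  "(map_poly of_rat (p ^ n) :: 'a :: field_char_0 poly) = map_poly of_rat p ^ n"
  by (induction n) (simp_all add: map_poly_of_rat_mult)

lemma map_poly_of_rat_eq_0_iff:
  "(map_poly of_rat p :: 'a :: field_char_0 poly) = 0 \<longleftrightarrow> p = 0"
  by (auto simp: poly_eq_iff coeff_map_poly)

lemma map_poly_of_rat_of_int:
  "(map_poly of_rat (map_poly of_int p) :: 'a :: field_char_0 poly) = map_poly of_int p"
  by (intro poly_eqI) (simp add: coeff_map_poly)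

lemma degree_map_poly_of_rat:
  "degree (map_poly of_rat p :: 'a :: field_char_0 poly) = degree p"
  by (rule degree_map_poly) simp

text \<open>Division with remainder survives the embedding: the image of \<open>p\<close> divides
  that of \<open>q mod p\<close>, whose degree is too small unless it is zero. Thus divisibility
  over the rationals can be tested at complex roots.\<close>

lemma map_poly_of_rat_dvd_iff:
  "(map_poly of_rat p :: 'a :: field_char_0 poly) dvd map_poly of_rat q \<longleftrightarrow> p dvd q"
proof
  let ?h = "map_poly of_rat :: rat poly \<Rightarrow> 'a poly"
  assume "?h p dvd ?h q"
  moreover have "?h q = ?h p * ?h (q div p) + ?h (q mod p)"
    by (simp flip: map_poly_of_rat_mult map_poly_of_rat_add)
  ultimately have dvd: "?h p dvd ?h (q mod p)"
    by (simp add: dvd_add_right_iff)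
  show "p dvd q"
  proof (cases "p = 0")
    case True
    with \<open>?h p dvd ?h q\<close> show ?thesis by (simp add: map_poly_of_rat_eq_0_iff)
  next
    case False
    have "q mod p = 0"
    proof (rule ccontr)
      assume nz: "q mod p \<noteq> 0"
      hence "degree (q mod p) < degree p" using False degree_mod_less by blast
      moreover have "degree p \<le> degree (q mod p)"
        using dvd_imp_degree_le[OF dvd] nz by (simp add: degree_map_poly_of_rat map_poly_of_rat_eq_0_iff)
      ultimately show False by simp
    qed
    thus ?thesis by auto
  qed
qed (auto simp: map_poly_of_rat_mult elim!: dvdE)

text \<open>The fraction need not be in lowest terms. If \<open>a / c\<close> is its reduced form,
  \<open>a * G = c * F\<close> shows that the order of \<open>a\<close> at \<open>z\<close> is at
  least that of \<open>F\<close> minus that of \<open>G\<close>. The case \<open>F = 0\<close> is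
  split off because the order of the zero polynomial says nothing; there
  \<open>a = 0\<close>.\<close>

lemma vanishes_mod_if_order_le:
  fixes F G :: "rat poly"
  assumes A: "A = to_fract F / to_fract G" and G: "G \<noteq> 0"
  assumes R: "finite R" and P: "map_poly of_int P = (\<Prod>z\<in>R. [:-z, 1 :: complex:] ^ e z)"
  assumes ord: "\<And>z. z \<in> R \<Longrightarrow> F \<noteq> 0 \<Longrightarrow> order z (map_poly of_rat G) + e z \<le> order z (map_poly of_rat F)"
  shows "vanishes_mod A P"
proof -
  let ?h = "map_poly of_rat :: rat poly \<Rightarrow> complex poly"
  obtain a c where ac: "quot_of_fract A = (a, c)" by (cases "quot_of_fract A")
  have c: "c \<noteq> 0"
    using quot_of_fract_in_normalized_fracts[of A] by (auto simp: ac normalized_fracts_def)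
  have "A = to_fract a / to_fract c"
    using quot_to_fract_quot_of_fract[of A] by (simp add: ac quot_to_fract_def Fract_conv_to_fract)
  hence "to_fract (a * G) = to_fract (c * F)"
    using A c G by (simp add: field_simps)
  hence eq: "a * G = c * F" by (simp only: to_fract_eq_iff)
  have "(\<Prod>z\<in>R. [:-z, 1:] ^ e z) dvd ?h a"
  proof (rule prod_linear_powers_dvd[OF R])
    fix z assume z: "z \<in> R"
    show "[:-z, 1:] ^ e z dvd ?h a"
    proof (cases "a = 0")
      case False
      hence nz: "a * G \<noteq> 0" using G by simp
      hence "F \<noteq> 0" using eq by auto
      have "order z (?h a) + order z (?h G) = order z (?h (a * G))"
        using nz by (simp add: map_poly_of_rat_mult order_mult map_poly_of_rat_eq_0_iff)
      also have "\<dots> = order z (?h c) + order z (?h F)"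
        using nz unfolding eq by (simp add: map_poly_of_rat_mult order_mult map_poly_of_rat_eq_0_iff)
      finally have "e z \<le> order z (?h a)" using ord[OF z \<open>F \<noteq> 0\<close>] by simp
      thus ?thesis by (simp add: order_divides)
    qed simp
  qed
  hence "?h (map_poly of_int P) dvd ?h a"
    by (simp only: P map_poly_of_rat_of_int)
  hence "map_poly of_int P dvd a" by (simp only: map_poly_of_rat_dvd_iff)
  thus ?thesis by (simp add: vanishes_mod_def ac)
qed

section \<open>Factorization of the modulus over the complex numbers\<close>

text \<open>Dividing \<open>q ^ m - 1\<close> by \<open>q - 1\<close> removes the root 1 and leaves
  each other root once. The squared cyclotomic factor adds 2 at the primitive roots, none of which
  is 1 because \<open>m > 1\<close>.\<close>

lemma modulus_eq_prod:
  assumes m: "m > 1"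
  shows "map_poly of_int (q_int_poly m * cyclotomic m ^ 2) =
    (\<Prod>z\<in>{z. z ^ m = 1} - {1 :: complex}. [:-z, 1:] ^ (if z \<in> primitive_roots m then 3 else 1))"
proof -
  let ?R = "{z :: complex. z ^ m = 1} - {1}"
  have fin: "finite {z :: complex. z ^ m = 1}" using m by (intro finite_roots_unity) auto
  have "map_poly of_int (q_int_poly m) = (\<Sum>i<m. monom (1 :: complex) i)"
    by (simp add: q_int_poly_def map_poly_of_int_sum map_poly_monom)
  also have "\<dots> = (\<Sum>i<m. [:0, 1:] ^ i)"
    by (simp add: monom_altdef)
  finally have "map_poly of_int (q_int_poly m) = (\<Sum>i<m. [:0, 1 :: complex:] ^ i)" .
  hence "[:-1, 1:] * map_poly of_int (q_int_poly m) = [:0, 1 :: complex:] ^ m - 1"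
    by (simp only: power_diff_1_eq) (simp add: one_pCons del: mult_pCons_left)
  also have "\<dots> = (\<Prod>z | z ^ m = 1. [:- z, 1 :: complex:])"
    using monom_minus_1_eq_prod[of m] m by (simp add: monom_altdef)
  also have "\<dots> = [:-1, 1:] * (\<Prod>z\<in>?R. [:-z, 1:])"
    using fin by (subst prod.remove[of _ 1]) auto
  finally have q: "map_poly of_int (q_int_poly m) = (\<Prod>z\<in>?R. [:-z, 1 :: complex:])"
    by (subst (asm) mult_left_cancel) auto
  have "1 \<notin> primitive_roots m" using m by (auto simp: primitive_roots_def)
  hence sub: "primitive_roots m \<subseteq> ?R" by (auto simp: primitive_roots_def)
  have c: "map_poly of_int (cyclotomic m) =
      (\<Prod>z\<in>?R. if z \<in> primitive_roots m then [:-z, 1 :: complex:] else 1)"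
    using m fin sub
    by (simp add: cyclotomic_eq prod.If_cases Int_absorb1)
  show ?thesis
    unfolding power2_eq_square map_poly_of_int_mult q c prod.distrib[symmetric]
    by (intro prod.cong) (auto simp: power3_eq_cube mult.assoc)
qed

section \<open>The q-expressions as quotients of polynomials\<close>

lemma qvar_neq_0: "qvar \<noteq> 0"
  by (simp add: qvar_def)

lemma to_fract_monom: "to_fract (monom 1 j) = qvar ^ j"
proof (induction j)
  case (Suc j)
  have "monom 1 (Suc j) = [:0, 1:] * (monom 1 j :: rat poly)"
    by (simp add: monom_Suc)
  thus ?case using Suc by (simp add: qvar_def del: mult_pCons_left)
qed (simp add: monom_0 flip: one_pCons)

lemma qvar_power_neq_1: "j > 0 \<Longrightarrow> qvar ^ j \<noteq> 1"
  using one_minus_monom_neq_0[of j, where ?'a = rat]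
  by (metis eq_iff_diff_eq_0 to_fract_1 to_fract_eq_iff to_fract_monom)

lemma q_int_linear:
  "q_int (int l * int k - int r) = (1 - qvar powi (- int r) * (qvar ^ l) ^ k) / (1 - qvar)"
  using qvar_neq_0
  by (simp add: q_int_def power_int_diff power_int_minus field_simps flip: of_nat_mult power_mult)

lemma q_int_mult:
  "q_int (int l * int k) = (1 - (qvar ^ l) ^ k) / (1 - qvar)"
  by (simp add: q_int_def power_mult flip: of_nat_mult)

text \<open>Each of the \<open>Suc n\<close> numerator factors is
  \<open>1 - q ^ (l * k - r) = (q ^ r - q ^ (l * k)) / q ^ r\<close>, which accounts for the power
  of \<open>q\<close> in the denominator.\<close>

lemma q_poch_quotient:
  "q_poch (qvar powi (- int r)) (qvar ^ l) (Suc n) / q_poch (qvar ^ l) (qvar ^ l) n =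
   to_fract (numer r l n) / to_fract (monom 1 (r * Suc n) * denom l n)"
proof -
  have to_fract_prod: "to_fract (prod f A) = (\<Prod>x\<in>A. to_fract (f x))"
    for f :: "nat \<Rightarrow> rat poly" and A
    by (induction A rule: infinite_finite_induct) simp_all
  have "q_poch (qvar powi (- int r)) (qvar ^ l) (Suc n) =
      (\<Prod>k\<le>n. to_fract (monom 1 r - monom 1 (l * k)) / qvar ^ r)"
    unfolding q_poch_def lessThan_Suc_atMost
    using qvar_neq_0
    by (intro prod.cong) (simp_all add: to_fract_monom power_int_minus field_simps flip: power_mult)
  also have "\<dots> = to_fract (numer r l n) / qvar ^ (r * Suc n)"
    unfolding numer_def to_fract_prod prod_dividef
    by (simp only: power_mult prod_constant card_atMost)
  finally have num: "q_poch (qvar powi (- int r)) (qvar ^ l) (Suc n) =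
      to_fract (numer r l n) / qvar ^ (r * Suc n)" .
  have "q_poch (qvar ^ l) (qvar ^ l) n = to_fract (denom l n)"
    unfolding denom_def to_fract_prod q_poch_def
    by (simp add: to_fract_monom power_mult power_add)
  thus ?thesis unfolding num by (simp add: to_fract_monom)
qed

lemma map_poly_of_rat_numer:
  "(map_poly of_rat (numer r l n) :: 'a :: field_char_0 poly) = numer r l n"
  by (simp add: numer_def map_poly_of_rat_prod map_poly_of_rat_diff map_poly_monom)

lemma map_poly_of_rat_denom:
  "(map_poly of_rat (denom l n) :: 'a :: field_char_0 poly) = denom l n"
  by (simp add: denom_def map_poly_of_rat_prod map_poly_of_rat_diff map_poly_monom)

section \<open>Orders of the telescoped sum at the roots of the modulus\<close>

theorem theorem1p1:
  fixes r l m s :: nat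
  assumes "r \<ge> 1" and "l \<ge> 2" and "m > 0"
    and "[int m = - int r] (mod int l)"
    and "gcd m l = 1"
    and "real m > (2 * real l * real s + real r) / (real l - 1)"
  shows "vanishes_mod
    (\<Sum>n = s..(m + r) div l + s.
       (-1) ^ n *
       ((q_poch (qvar powi (- int r)) (qvar ^ l) (n + s) *
         q_poch (qvar powi (- int r)) (qvar ^ l) (n - s) *
         q_poch (qvar powi (- int r)) (qvar ^ l) n) /
        (q_poch (qvar ^ l) (qvar ^ l) (n + s) *
         q_poch (qvar ^ l) (qvar ^ l) (n - s) *
         q_poch (qvar ^ l) (qvar ^ l) n)) *
       (q_int (int l * (int n + int s) - int r) *
        q_int (int l * (int n - int s) - int r) *
        q_int (int l * int n - int r) +
        q_int (int l * (int n + int s)) *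
        q_int (int l * (int n - int s)) *
        q_int (int l * int n)))
    (q_int_poly m * cyclotomic m ^ 2)"
proof -
  define N where "N = (m + r) div l"
  define a p where "a = qvar powi (- int r)" and "p = qvar ^ l"
  define V where "V n = q_poch a p (Suc n) / q_poch p p n" for n
  have "int l dvd int (m + r)"
    using assms(4) by (simp add: cong_iff_dvd_diff)
  hence "l dvd m + r" by (simp only: of_nat_dvd_iff)
  hence lN: "l * N = m + r" by (simp add: N_def)
  have ndvd: "\<not> l dvd r"
  proof
    assume "l dvd r"
    hence "l dvd m" using \<open>l dvd m + r\<close> by (simp add: dvd_add_left_iff)
    thus False using assms(2,5) by (simp add: gcd_nat.absorb2)
  qed
  \<comment> \<open>Adding \<open>m\<close> to both sides turns the left into
    \<open>l * (N + 2 * s)\<close> and the right into \<open>l * m\<close>, so that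
    \<open>N + 2 * s < m\<close>.\<close>
  have "2 * real l * real s + real r < real m * (real l - 1)"
    using assms(2,6) by (simp add: field_simps)
  hence "real (2 * l * s + r + m) < real (l * m)"
    by (simp add: algebra_simps)
  moreover have "2 * l * s + r + m = l * (N + 2 * s)"
    using lN by (simp add: distrib_left)
  ultimately have "l * (N + 2 * s) < l * m"
    by (simp only: of_nat_less_iff)
  hence Nm: "N + 2 * s < m" by simp
  have N0: "N > 0" using lN assms(3) by (cases N) auto
  have m1: "m > 1" using Nm N0 by simp

  define F :: "rat poly" where
    "F = (-1) ^ (N + s) * (numer r l (N + 2 * s) * numer r l N * numer r l (N + s))"
  \<comment> \<open>\<open>H\<close> collects the part of the denominator whose only zeros are 0 and
    1, neither of which is a root of the modulus.\<close>
  define H :: "rat poly" where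
    "H = monom 1 (r * Suc (N + 2 * s) + r * Suc N + r * Suc (N + s)) * (1 - monom 1 1) ^ 3"
  define G :: "rat poly" where
    "G = denom l (N + 2 * s) * denom l N * denom l (N + s) * H"

  have "(\<Sum>n = s..N + s. (-1) ^ n *
       ((q_poch a p (n + s) * q_poch a p (n - s) * q_poch a p n) /
        (q_poch p p (n + s) * q_poch p p (n - s) * q_poch p p n)) *
       (q_int (int l * (int n + int s) - int r) *
        q_int (int l * (int n - int s) - int r) *
        q_int (int l * int n - int r) +
        q_int (int l * (int n + int s)) *
        q_int (int l * (int n - int s)) *
        q_int (int l * int n))) =
     (\<Sum>n = s..N + s. (-1) ^ n *
       ((q_poch a p (n + s) * q_poch a p (n - s) * q_poch a p n) /
        (q_poch p p (n + s) * q_poch p p (n - s) * q_poch p p n)) *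
       ((1 - a * p ^ (n + s)) * (1 - a * p ^ (n - s)) * (1 - a * p ^ n) +
        (1 - p ^ (n + s)) * (1 - p ^ (n - s)) * (1 - p ^ n))) / (1 - qvar) ^ 3"
    (is "?S = _")
    unfolding sum_divide_distrib
  proof (intro sum.cong refl)
    \<comment> \<open>On this range \<open>n - s\<close> is not truncated, so the integer arguments
      of \<open>q_int\<close> match the natural exponents.\<close>
    fix n assume "n \<in> {s..N + s}"
    hence n: "int n + int s = int (n + s)" "int n - int s = int (n - s)"
      by simp_all
    show "(-1) ^ n *
       ((q_poch a p (n + s) * q_poch a p (n - s) * q_poch a p n) /
        (q_poch p p (n + s) * q_poch p p (n - s) * q_poch p p n)) *
       (q_int (int l * (int n + int s) - int r) *
        q_int (int l * (int n - int s) - int r) *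
        q_int (int l * int n - int r) +
        q_int (int l * (int n + int s)) *
        q_int (int l * (int n - int s)) *
        q_int (int l * int n)) =
       (-1) ^ n *
       ((q_poch a p (n + s) * q_poch a p (n - s) * q_poch a p n) /
        (q_poch p p (n + s) * q_poch p p (n - s) * q_poch p p n)) *
       ((1 - a * p ^ (n + s)) * (1 - a * p ^ (n - s)) * (1 - a * p ^ n) +
        (1 - p ^ (n + s)) * (1 - p ^ (n - s)) * (1 - p ^ n)) / (1 - qvar) ^ 3"
      unfolding n q_int_linear q_int_mult a_def[symmetric] p_def[symmetric]
      by (simp add: power3_eq_cube flip: add_divide_distrib)
  qed
  also have "\<dots> = (-1) ^ (N + s) * (V (N + 2 * s) * V N * V (N + s)) / (1 - qvar) ^ 3"
    unfolding V_def p_def using assms(2)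
    by (subst telescoping_sum) (auto simp flip: power_mult intro!: qvar_power_neq_1)
  also have "\<dots> = to_fract F / to_fract G"
  proof -
    have minus_one: "to_fract ((-1) ^ k :: rat poly) = (-1) ^ k" for k
      by (induction k) simp_all
    show ?thesis
      unfolding V_def a_def p_def q_poch_quotient F_def G_def H_def to_fract_mult minus_one
      by (simp add: to_fract_monom power3_eq_cube power_add mult_ac)
  qed
  finally have S: "?S = to_fract F / to_fract G" .

  let ?R = "{z. z ^ m = 1} - {1 :: complex}"
  have "vanishes_mod ?S (q_int_poly m * cyclotomic m ^ 2)"
  proof (rule vanishes_mod_if_order_le[OF S _ _ modulus_eq_prod[OF m1]])
    have "l > 0" using assms(2) by simp
    thus G0: "G \<noteq> 0"
      using denom_neq_0[OF \<open>l > 0\<close>, where ?'a = rat] one_minus_monom_neq_0[of 1, where ?'a = rat]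
      by (simp add: G_def H_def)
    show "finite ?R" using m1 by (intro finite_Diff finite_roots_unity) auto
    fix z assume z: "z \<in> ?R" and F0: "F \<noteq> 0"
    let ?h = "map_poly of_rat :: rat poly \<Rightarrow> complex poly"
    from z obtain d where d: "d dvd m" "z \<in> primitive_roots d"
      using roots_unity_eq_Union[OF assms(3)] by auto
    have d0: "d > 0" using d(1) assms(3) by (cases "d = 0") auto
    have zd: "z ^ d = 1" using d(2) by (simp add: primitive_roots_def)
    have cop: "coprime d l"
      using d(1) assms(5) by (metis coprime_iff_gcd_eq_1 coprime_divisors dvd_refl)
    have "poly (?h H) z \<noteq> 0"
      using z assms(3) unfolding H_def map_poly_of_rat_mult map_poly_of_rat_power map_poly_of_rat_diff
      by (auto simp: poly_monom map_poly_monom power_0_left)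
    hence "order z (?h H) = 0" by (rule order_0I)
    hence ordG: "order z (?h G) = (N + 2 * s) div d + N div d + (N + s) div d"
      using order_denom[OF d(2) d0 \<open>l > 0\<close> cop] denom_neq_0[OF \<open>l > 0\<close>, where ?'a = complex] G0
      unfolding G_def map_poly_of_rat_mult map_poly_of_rat_denom
      by (simp add: order_mult map_poly_of_rat_eq_0_iff)
    have "?h F = (-1) ^ (N + s) * (numer r l (N + 2 * s) * numer r l N * numer r l (N + s))"
      unfolding F_def map_poly_of_rat_mult map_poly_of_rat_power map_poly_of_rat_numer
      by (simp add: map_poly_of_rat_diff[of 0 1, simplified])
    hence "order z (?h F) = order z (numer r l (N + 2 * s) * numer r l N * numer r l (N + s))"
      by (cases "even (N + s)") simp_all
    hence ordF: "order z (?h F) = order z (numer r l (N + 2 * s)) + order z (numer r l N) +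
        order z (numer r l (N + s))"
      using numer_neq_0[OF ndvd, where ?'a = complex] by (simp add: order_mult)
    have zN: "z ^ (l * N) = z ^ r" using z by (simp add: lN power_add)
    note ge = order_numer_ge[OF zd zN d0 ndvd]
    \<comment> \<open>The index \<open>k = N\<close> is itself in the counted residue class, which
      gives one zero more than \<open>denom l N\<close> has.\<close>
    have ge_N: "Suc (N div d) \<le> order z (numer r l N)"
    proof -
      have "N + (d - N mod d) = d * Suc (N div d)"
        using d0 mult_div_mod_eq[of d N] mod_less_divisor[OF d0, of N] by (simp; linarith)
      thus ?thesis using ge[of N] d0 by simp
    qed
    have ge_div: "n div d \<le> order z (numer r l n)" for n
      using ge[of n] div_le_mono[of n "n + (d - N mod d)" d] by linarith
    show "order z (?h G) + (if z \<in> primitive_roots m then 3 else 1) \<le> order z (?h F)"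
    proof (cases "z \<in> primitive_roots m")
      \<comment> \<open>The modulus has a simple zero here. The surplus zero of
        \<open>numer r l N\<close> supplies it, and the other two quotients have no pole.\<close>
      case False
      thus ?thesis using ordG ordF ge_N ge_div[of "N + 2 * s"] ge_div[of "N + s"] by simp
    next
      \<comment> \<open>Now \<open>d = m\<close> exceeds all three indices, so \<open>G\<close> does
        not vanish at \<open>z\<close>. Each numerator contains the factor \<open>k = N\<close> and
        so has a zero, which yields the required order 3.\<close>
      case True
      hence "d = m" using primitive_roots_disjoint[OF d0 assms(3)] d(2) by blast
      have ge_1: "1 \<le> order z (numer r l n)" if "N \<le> n" for n
      proof -
        have "d \<le> n + (d - N mod d)" using that mod_less_eq_dividend[of N d] by linarith
        hence "1 \<le> (n + (d - N mod d)) div d"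
          using d0 by (simp add: Suc_le_eq div_greater_zero_iff)
        thus ?thesis using ge[of n] by linarith
      qed
      show ?thesis
        using ordG ordF True Nm \<open>d = m\<close> ge_1[of N] ge_1[of "N + s"] ge_1[of "N + 2 * s"] by simp
    qed
  qed
  thus ?thesis unfolding N_def a_def p_def .
qed

end
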